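(* Let $A\in\mathbb{R}^{m\times n}$ with $m\ll n$ have full row rank and let $b\in\mathbb{R}^m$. Suppose the basis pursuit problem $\min_{x\in\mathbb{R}^n}\{\|x\|_1:Ax=b\}$ has a unique optimal solution $x_*$. Let $x^{(0)}\in\mathbb{R}^n$, let $\eta>0$ satisfy $\eta\ge\|x_*\|_1$, and let $\{(\lambda^{(k)},\epsilon^{(k)},\tau^{(k)})\}_{k\ge1}$ be positive parameters such that (i) $\lambda^{(k)}\searrow0$; (ii) $\epsilon^{(k)}\searrow0$ and there is a constant $B_1$ with $\epsilon^{(k)}/(\lambda^{(k)})^2\le B_1$ for all $k\ge1$; (iii) $\tau^{(k)}\searrow0$, there is a constant $B_2$ with $\tau^{(k)}/\lambda^{(k)}\le B_2$ for all $k\ge1$, and $\tau^{(k)}/\lambda^{(k)}\to0$ as $k\to\infty$. Let $\{x^{(k)}\}_{k\ge1}$ be the sequence of iterates generated by Algorithm FAL with these inputs (run without termination). Then $\lim_{k\to\infty}x^{(k)}=x_*$.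
   Context: Here $\sigma_{\max}(A)$ is the largest singular value of $A$. Algorithm FAL. Inputs: a sequence $\{(\lambda^{(k)},\epsilon^{(k)},\tau^{(k)})\}_{k\ge1}$ of positive numbers, $x^{(0)}\in\mathbb{R}^n$, and $\eta>0$. Set $\theta^{(1)}=0\in\mathbb{R}^m$ and $L=\sigma_{\max}(A)^2$. For $k=1,2,\dots$: - Define $p^{(k)}(x)=\lambda^{(k)}\|x\|_1$, $f^{(k)}(x)=\tfrac12\|Ax-b-\lambda^{(k)}\theta^{(k)}\|_2^2$, $P^{(k)}=p^{(k)}+f^{(k)}$, $h^{(k)}(x)=\tfrac12\|x-x^{(k-1)}\|_2^2$, $\eta^{(k)}=\eta+\tfrac{\lambda^{(k)}}{2}\|\theta^{(k)}\|_2^2$, $F^{(k)}=\{x\in\mathbb{R}^n:\|x\|_1\le\eta^{(k)}\}$, $\ell^{(k)}_{\max}=\sigma_{\max}(A)\,(\eta^{(k)}+\|x^{(k-1)}\|_2)\sqrt{2/\epsilon^{(k)}}$. - Let $x^{(k)}$ be the output of the subroutine APG described next (applied with $p=p^{(k)}$, $f=f^{(k)}$, $F=F^{(k)}$, $h=h^{(k)}$, Lipschitz constant $L$). - Set $\theta^{(k+1)}=\theta^{(k)}-\dfrac{Ax^{(k)}-b}{\lambda^{(k)}}$. Subroutine APG (accelerated proximal gradient) at outer iteration $k$: set $u^{(0)}=x^{(k-1)}$, $w^{(0)}=\operatorname{argmin}_x h^{(k)}(x)=x^{(k-1)}$, $\vartheta^{(0)}=1$. For $\ell=0,1,2,\dots$: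 - If $\ell\ge\ell^{(k)}_{\max}$, stop and return $u^{(\ell)}$. - Set $v^{(\ell)}=(1-\vartheta^{(\ell)})u^{(\ell)}+\vartheta^{(\ell)}w^{(\ell)}$. If there is a subgradient $g\in\partial P^{(k)}(v^{(\ell)})$ with $\|g\|_2\le\tau^{(k)}$, stop and return $v^{(\ell)}$. - Set $w^{(\ell+1)}=\operatorname{argmin}_{z\in F^{(k)}}\Big\{\sum_{i=0}^{\ell}\tfrac{1}{\vartheta^{(i)}}\big(p^{(k)}(z)+\nabla f^{(k)}(v^{(i)})^Tz\big)+L\,h^{(k)}(z)\Big\}$. - Set $u^{(\ell+1)}=\operatorname{argmin}_{x\in F^{(k)}}\Big\{p^{(k)}(x)+\nabla f^{(k)}(v^{(\ell)})^Tx+\tfrac{L}{2}\|x-v^{(\ell)}\|_2^2\Big\}$. - Set $\vartheta^{(\ell+1)}=\tfrac12\Big(\sqrt{(\vartheta^{(\ell)})^4+4(\vartheta^{(\ell)})^2}-(\vartheta^{(\ell)})^2\Big)$. *)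

theory Defs
  imports "HOL-Analysis.Analysis"
begin

definition l1_norm :: "real^'n \<Rightarrow> real" where
  "l1_norm x = (\<Sum>i\<in>UNIV. \<bar>x $ i\<bar>)"

text \<open>For \<open>CARD('m) < CARD('n)\<close> this notion adds the value \<open>0\<close> to the usual list of
  \<open>CARD('m)\<close> singular values; the largest one is not affected.\<close>

definition singular_value :: "real^'n^'m \<Rightarrow> real \<Rightarrow> bool" where
  "singular_value A s \<longleftrightarrow>
     s \<ge> 0 \<and> (\<exists>v. v \<noteq> 0 \<and> (transpose A ** A) *v v = s^2 *\<^sub>R v)"

definition sigma_max :: "real^'n^'m \<Rightarrow> real" where
  "sigma_max A = Max {s. singular_value A s}"

definition subdifferential :: "('a::real_inner \<Rightarrow> real) \<Rightarrow> 'a \<Rightarrow> 'a set" where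
  "subdifferential P x = {g. \<forall>y. P x + g \<bullet> (y - x) \<le> P y}"

definition gradient :: "('a::real_inner \<Rightarrow> real) \<Rightarrow> 'a \<Rightarrow> 'a" where
  "gradient f x = (THE D. GDERIV f x :> D)"

definition decreases_to_zero :: "(nat \<Rightarrow> real) \<Rightarrow> bool" where
  "decreases_to_zero s \<longleftrightarrow> antimono_on {1..} s \<and> s \<longlonglongrightarrow> 0"

definition unique_minimizer :: "('a \<Rightarrow> real) \<Rightarrow> ('a \<Rightarrow> bool) \<Rightarrow> 'a \<Rightarrow> bool" where
  "unique_minimizer f C x \<longleftrightarrow> is_arg_min f C x \<and> (\<forall>y. is_arg_min f C y \<longrightarrow> y = x)"

text \<open>\<open>APG_output p f h F L lmax tau x0 z\<close>: the subroutine, started at \<open>x0\<close>, returns \<open>z\<close>.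
  \<open>N\<close> is the value of the loop counter at which it stops; the step equations are only
  imposed up to that point. The test \<open>l \<ge> lmax\<close> takes precedence over the subgradient test.\<close>

definition APG_output ::
  "('a::real_inner \<Rightarrow> real) \<Rightarrow> ('a \<Rightarrow> real) \<Rightarrow> ('a \<Rightarrow> real) \<Rightarrow> 'a set \<Rightarrow> real \<Rightarrow> real \<Rightarrow> real \<Rightarrow>
   'a \<Rightarrow> 'a \<Rightarrow> bool" where
  "APG_output p f h F L lmax tau x0 z \<longleftrightarrow>
    (let small_subgrad = (\<lambda>y. \<exists>g \<in> subdifferential (\<lambda>x. p x + f x) y. norm g \<le> tau) in
     \<exists>(u :: nat \<Rightarrow> 'a) (v :: nat \<Rightarrow> 'a) (w :: nat \<Rightarrow> 'a) (t :: nat \<Rightarrow> real) (N :: nat).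
       u 0 = x0 \<and> is_arg_min h (\<lambda>_. True) (w 0) \<and> t 0 = 1 \<and>
       (\<forall>l\<le>N. v l = (1 - t l) *\<^sub>R u l + t l *\<^sub>R w l) \<and>
       (\<forall>l<N.
          real l < lmax \<and> \<not> small_subgrad (v l) \<and>
          is_arg_min (\<lambda>y. (\<Sum>i\<le>l. (1 / t i) * (p y + gradient f (v i) \<bullet> y)) + L * h y)
            (\<lambda>y. y \<in> F) (w (Suc l)) \<and>
          is_arg_min (\<lambda>y. p y + gradient f (v l) \<bullet> y + L / 2 * (norm (y - v l))^2)
            (\<lambda>y. y \<in> F) (u (Suc l)) \<and>
          t (Suc l) = (sqrt ((t l)^4 + 4 * (t l)^2) - (t l)^2) / 2) \<and>
       (if real N \<ge> lmax then z = u N else small_subgrad (v N) \<and> z = v N))"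

text \<open>\<open>FAL_iterates A b eta lam eps tau x0 x\<close>: \<open>x\<close> is the infinite sequence of outer iterates.
  The parameters, \<open>theta\<close> and the outer loop are indexed from 1; values of the
  parameters at index 0 are irrelevant. When the parameters and \<open>eta\<close> are positive and
  \<open>A\<close> is nonzero, all minimizers occurring in the subroutine exist and are unique.\<close>

definition FAL_iterates ::
  "real^'n^'m \<Rightarrow> real^'m \<Rightarrow> real \<Rightarrow> (nat \<Rightarrow> real) \<Rightarrow> (nat \<Rightarrow> real) \<Rightarrow> (nat \<Rightarrow> real) \<Rightarrow>
   real^'n \<Rightarrow> (nat \<Rightarrow> real^'n) \<Rightarrow> bool" where
  "FAL_iterates A b eta lam eps tau x0 x \<longleftrightarrow>
    x 0 = x0 \<and>
    (\<exists>theta :: nat \<Rightarrow> real^'m.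
       theta 1 = 0 \<and>
       (\<forall>k\<ge>1.
          (let eta_k = eta + lam k / 2 * (norm (theta k))^2 in
           APG_output
             (\<lambda>y. lam k * l1_norm y)
             (\<lambda>y. 1 / 2 * (norm (A *v y - b - lam k *\<^sub>R theta k))^2)
             (\<lambda>y. 1 / 2 * (norm (y - x (k - 1)))^2)
             {y. l1_norm y \<le> eta_k}
             ((sigma_max A)^2)
             (sigma_max A * (eta_k + norm (x (k - 1))) * sqrt (2 / eps k))
             (tau k)
             (x (k - 1))
             (x k)) \<and>
          theta (Suc k) = theta k - (1 / lam k) *\<^sub>R (A *v x k - b)))"

end

theory Submission
  imports Defs
begin

text \<open>
  Every outer iterate \<open>x\<^sub>k\<close> satisfies \<open>P\<^sub>k x\<^sub>k \<le> P\<^sub>k y + \<tau>\<^sub>k \<bar>y - x\<^sub>k\<bar> + \<epsilon>\<^sub>k\<close> for all \<open>y\<close>, whichever stopping test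
  ended the subroutine: the subgradient test gives the \<open>\<tau>\<close> term, the iteration bound together with the
  \<open>O(1/l\<^sup>2)\<close> rate of the accelerated method gives the \<open>\<epsilon>\<close> term. Since
  \<open>\<nabla>f\<^sub>k x\<^sub>k = - \<lambda>\<^sub>k A\<^sup>T \<theta>\<^sub>k\<^sub>+\<^sub>1\<close>, testing with a step of length \<open>\<lambda>\<^sub>k\<close> along the negative gradient bounds
  \<open>A\<^sup>T \<theta>\<^sub>k\<^sub>+\<^sub>1\<close>, hence \<open>\<theta>\<^sub>k\<^sub>+\<^sub>1\<close> by full row rank. Then \<open>A x\<^sub>k - b = \<lambda>\<^sub>k (\<theta>\<^sub>k - \<theta>\<^sub>k\<^sub>+\<^sub>1)\<close> tends to 0, and testing
  with \<open>y = x\<^sub>*\<close> shows that the \<open>l\<^sub>1\<close> norms of the iterates are asymptotically at most that of \<open>x\<^sub>*\<close>. So all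
  limit points of the bounded sequence are optimal, and therefore equal to \<open>x\<^sub>*\<close>.
\<close>

section \<open>The largest singular value\<close>

lemma inner_transpose_mult:
  fixes A :: "real^'n^'m"
  shows "x \<bullet> (transpose A *v y) = (A *v x) \<bullet> y"
  by (metis dot_lmul_matrix inner_commute transpose_matrix_vector)

text \<open>Distinct singular values \<open>s\<close> give distinct eigenvalues \<open>s^2\<close>
  of the symmetric matrix \<open>transpose A ** A\<close>, so chosen eigenvectors are orthogonal,
  hence independent. Finiteness is what makes the \<open>Max\<close> in \<open>sigma_max\<close>
  meaningful.\<close>

lemma finite_singular_values:
  fixes A :: "real^'n^'m"
  shows "finite {s. singular_value A s}"
proof -
  let ?S = "{s. singular_value A s}"
  define M where "M = transpose A ** A"
  have "\<forall>s\<in>?S. \<exists>v. v \<noteq> 0 \<and> M *v v = s^2 *\<^sub>R v"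
    unfolding M_def singular_value_def by auto
  then obtain e where e: "\<And>s. s \<in> ?S \<Longrightarrow> e s \<noteq> 0 \<and> M *v e s = s^2 *\<^sub>R e s"
    by metis
  have sym: "(M *v y) \<bullet> z = y \<bullet> (M *v z)" for y z
    unfolding M_def matrix_vector_mul_assoc[symmetric]
    by (metis inner_commute inner_transpose_mult)
  have orth: "e s \<bullet> e r = 0" if "s \<in> ?S" "r \<in> ?S" "s \<noteq> r" for s r
  proof -
    have "s^2 * (e s \<bullet> e r) = r^2 * (e s \<bullet> e r)"
      using sym[of "e s" "e r"] e that by simp
    moreover have "s^2 \<noteq> r^2"
      using that by (auto simp: singular_value_def power2_eq_iff_nonneg)
    ultimately show ?thesis by simp
  qed
  have "inj_on e ?S" using orth e by (metis inj_onI inner_eq_zero_iff)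
  moreover have "pairwise orthogonal (e ` ?S)"
    unfolding pairwise_def orthogonal_def using orth by blast
  then have "finite (e ` ?S)"
    using e by (intro independent_imp_finite pairwise_orthogonal_independent) auto
  ultimately show ?thesis using finite_imageD by blast
qed

text \<open>The maximum of \<open>norm (A *v y)\<close> over the unit sphere is attained at some
  \<open>v\<close>; stationarity there makes \<open>v\<close> an eigenvector of
  \<open>transpose A ** A\<close>.\<close>

lemma exists_maximal_singular_value:
  fixes A :: "real^'n^'m"
  obtains s where "singular_value A s" and "\<And>y. norm (A *v y) \<le> s * norm y"
proof -
  have "continuous_on (sphere 0 1) (\<lambda>y. norm (A *v y))"
    by (intro continuous_intros)
  moreover have "sphere (0::real^'n) 1 \<noteq> {}" by (simp add: sphere_eq_empty)
  ultimately obtain v where v: "v \<in> sphere 0 1"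
      "\<And>y. y \<in> sphere 0 1 \<Longrightarrow> norm (A *v y) \<le> norm (A *v v)"
    using continuous_attains_sup[OF compact_sphere] by metis
  define s where "s = norm (A *v v)"
  define M where "M = transpose A ** A"
  have bound: "norm (A *v y) \<le> s * norm y" for y
  proof (cases "y = 0")
    case False
    have "norm (A *v ((1 / norm y) *\<^sub>R y)) \<le> s"
      unfolding s_def by (rule v) (use False in simp)
    then show ?thesis using False by (simp add: matrix_vector_mult_scaleR field_simps)
  qed simp
  have sym: "y \<bullet> (M *v z) = (A *v y) \<bullet> (A *v z)" for y z
    unfolding M_def matrix_vector_mul_assoc[symmetric] by (rule inner_transpose_mult)
  \<comment> \<open>\<open>d\<close> is half the gradient at \<open>v\<close> of the form named
    below; \<open>d = 0\<close> is the eigenvector equation.\<close>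
  define d where "d = s^2 *\<^sub>R v - M *v v"
  text \<open>First-order optimality of \<open>v\<close> for the nonnegative form \<open>s\<^sup>2 \<bar>y\<bar>\<^sup>2 - \<bar>A y\<bar>\<^sup>2\<close>, which vanishes at \<open>v\<close>.\<close>
  have ineq: "0 \<le> 2 * r * (d \<bullet> d) + r^2 * (s^2 * (d \<bullet> d) - (A *v d) \<bullet> (A *v d))" for r
  proof -
    have "(norm (A *v (v + r *\<^sub>R d)))^2 \<le> (s * norm (v + r *\<^sub>R d))^2"
      by (intro power_mono bound) simp
    moreover have "(norm (A *v (v + r *\<^sub>R d)))^2 =
        s^2 + 2 * r * ((A *v v) \<bullet> (A *v d)) + r^2 * ((A *v d) \<bullet> (A *v d))"
      unfolding s_def power2_norm_eq_inner
      by (simp add: matrix_vector_right_distrib matrix_vector_mult_scaleR inner_simps inner_commute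
          power2_eq_square)
    moreover have "v \<bullet> v = 1" using v(1) by (simp add: norm_eq_sqrt_inner)
    then have "(norm (v + r *\<^sub>R d))^2 = 1 + 2 * r * (v \<bullet> d) + r^2 * (d \<bullet> d)"
      unfolding power2_norm_eq_inner
      by (simp add: inner_simps inner_commute power2_eq_square)
    moreover have "d \<bullet> d = s^2 * (v \<bullet> d) - (A *v v) \<bullet> (A *v d)"
      using sym[of d v] by (subst d_def) (simp add: inner_simps inner_commute)
    then have "r * (d \<bullet> d) = r * (s^2 * (v \<bullet> d)) - r * ((A *v v) \<bullet> (A *v d))"
      by (simp only: right_diff_distrib)
    ultimately show ?thesis
      unfolding power_mult_distrib by (simp add: algebra_simps)
  qed
  have "d = 0"
  proof (rule ccontr)
    assume "d \<noteq> 0"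
    then have "0 < d \<bullet> d" by simp
    \<comment> \<open>The negative \<open>r\<close> chosen here is so small that
      \<open>r * K\<close> cannot outweigh \<open>2 * (d \<bullet> d)\<close>, which would make the
      right-hand side of \<open>ineq\<close> negative.\<close>
    define K where "K = s^2 * (d \<bullet> d) - (A *v d) \<bullet> (A *v d)"
    define r where "r = - (d \<bullet> d) / (\<bar>K\<bar> + 1)"
    have "r < 0" unfolding r_def using \<open>0 < d \<bullet> d\<close> by (simp add: divide_less_0_iff)
    have "r * (2 * (d \<bullet> d) + r * K) = 2 * r * (d \<bullet> d) + r^2 * K"
      by (simp add: algebra_simps power2_eq_square)
    then have "0 \<le> r * (2 * (d \<bullet> d) + r * K)" using ineq[of r] K_def by simp
    then have "2 * (d \<bullet> d) + r * K \<le> 0" using \<open>r < 0\<close> by (simp add: zero_le_mult_iff)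
    moreover have "- (d \<bullet> d) \<le> r * K"
    proof -
      have "\<bar>K\<bar> / (\<bar>K\<bar> + 1) \<le> 1" by (simp add: field_simps)
      then have "(d \<bullet> d) * (\<bar>K\<bar> / (\<bar>K\<bar> + 1)) \<le> (d \<bullet> d) * 1"
        using \<open>0 < d \<bullet> d\<close> by (intro mult_left_mono) auto
      then have "\<bar>r * K\<bar> \<le> d \<bullet> d" unfolding r_def by (simp add: abs_mult)
      then show ?thesis by linarith
    qed
    ultimately show False using \<open>0 < d \<bullet> d\<close> by simp
  qed
  then have "singular_value A s"
    using v(1) unfolding singular_value_def d_def M_def by (auto intro!: exI[of _ v] simp: s_def)
  then show thesis using bound that by blast
qed

lemma norm_matrix_vector_mult_le_sigma_max:
  "norm (A *v y) \<le> sigma_max A * norm y"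
proof -
  obtain s where s: "singular_value A s" "\<And>y. norm (A *v y) \<le> s * norm y"
    using exists_maximal_singular_value by blast
  have "s \<le> sigma_max A" unfolding sigma_max_def using s finite_singular_values by (intro Max_ge) auto
  then show ?thesis using s(2)[of y] by (meson mult_right_mono norm_ge_zero order_trans)
qed

section \<open>Accelerated proximal gradient method\<close>

text \<open>The recursion makes \<open>r = t (Suc l)\<close> the positive root of
  \<open>r^2 = (1 - r) * s^2\<close> with \<open>s = t l\<close>. Hence
  \<open>1 / s^2 + 1 / r = 1 / r^2\<close>, which yields both sums, and \<open>1 / t\<close> grows
  by at least 1/2 per step.\<close>

lemma APG_step_size:
  fixes t :: "nat \<Rightarrow> real"
  assumes "t 0 = 1"
    and step: "\<And>l. l < N \<Longrightarrow> t (Suc l) = (sqrt ((t l)^4 + 4 * (t l)^2) - (t l)^2) / 2"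
    and "l \<le> N"
  shows "0 < t l \<and> t l \<le> 1 \<and> (\<Sum>i\<le>l. 1 / t i) = 1 / (t l)^2 \<and>
    (\<Sum>i<l. 1 / t i) = (1 - t l) / (t l)^2 \<and> (real l + 2) / 2 \<le> 1 / t l"
  using \<open>l \<le> N\<close>
proof (induction l)
  case 0
  show ?case using \<open>t 0 = 1\<close> by simp
next
  case (Suc l)
  define s where "s = t l"
  define r where "r = t (Suc l)"
  define S where "S = sqrt (s^4 + 4 * s^2)"
  have IH: "0 < s" "(\<Sum>i\<le>l. 1 / t i) = 1 / s^2" "(real l + 2) / 2 \<le> 1 / s"
    using Suc unfolding s_def by auto
  have r: "r = (S - s^2) / 2"
    unfolding r_def S_def s_def using step[of l] Suc.prems by simp
  have SS: "S^2 = s^4 + 4 * s^2" unfolding S_def by simp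
  have "s^2 < S" unfolding S_def using IH(1) by (intro real_less_rsqrt) simp
  then have "0 < r" using r by simp
  have quad: "r^2 = (1 - r) * s^2"
    unfolding r using SS by (simp add: power2_eq_square power4_eq_xxxx field_simps)
  have "0 < (1 - r) * s^2" unfolding quad[symmetric] using \<open>0 < r\<close> by simp
  then have "r \<le> 1" using IH(1) by (simp add: zero_less_mult_iff)
  have gap: "1 / s^2 = (1 - r) / r^2"
    using quad \<open>0 < r\<close> IH(1) by (simp add: field_simps)
  have "1 / s^2 + 1 / r = 1 / r^2"
    unfolding gap using \<open>0 < r\<close> by (simp add: field_simps power2_eq_square)
  \<comment> \<open>Completing the square:
    \<open>(1 / r - 1 / 2)^2 = 1 / s^2 + 1 / 4\<close>.\<close>
  moreover from this have "(1 / s)^2 \<le> (1 / r - 1 / 2)^2"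
    by (simp add: power2_diff power_divide)
  moreover have "0 \<le> 1 / r - 1 / 2" using \<open>r \<le> 1\<close> \<open>0 < r\<close> by (simp add: field_simps)
  ultimately have "1 / s \<le> 1 / r - 1 / 2" using power2_le_imp_le by blast
  with IH \<open>0 < r\<close> \<open>r \<le> 1\<close> gap \<open>1 / s^2 + 1 / r = 1 / r^2\<close> show ?case
    unfolding r_def[symmetric] by (simp add: r_def lessThan_Suc_atMost)
qed

text \<open>The objective is strongly convex with modulus \<open>L\<close>, so it grows
  quadratically away from its minimizer. The proof compares \<open>w\<close> with points of the
  segment towards \<open>z\<close>.\<close>

lemma arg_min_quadratic_growth:
  fixes w z c :: "'a::real_inner"
  assumes "convex_on F q" and "0 \<le> L" and "z \<in> F"
    and "is_arg_min (\<lambda>y. q y + L / 2 * (norm (y - c))^2) (\<lambda>y. y \<in> F) w"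
  shows "q w + L / 2 * (norm (w - c))^2 + L / 2 * (norm (z - w))^2 \<le> q z + L / 2 * (norm (z - c))^2"
proof -
  define D where "D = q z + L / 2 * (norm (z - c))^2 - (q w + L / 2 * (norm (w - c))^2)"
  have "w \<in> F" and min: "\<And>y. y \<in> F \<Longrightarrow> q w + L / 2 * (norm (w - c))^2 \<le> q y + L / 2 * (norm (y - c))^2"
    using assms(4) by (auto simp: is_arg_min_def not_less)
  have "convex F" using assms(1) by (simp add: convex_on_def)
  \<comment> \<open>Along the segment the squared norm lies below its chord by a multiple of
    \<open>s * (1 - s)\<close>. Dividing by \<open>s\<close> and letting \<open>s\<close> tend to 0
    from the right gives the claim.\<close>
  have "(1 - s) * (L / 2 * (norm (z - w))^2) \<le> D" if s: "s \<in> {0<..<1}" for s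
  proof -
    define y where "y = (1 - s) *\<^sub>R w + s *\<^sub>R z"
    have "y \<in> F" unfolding y_def using \<open>convex F\<close> \<open>w \<in> F\<close> \<open>z \<in> F\<close> s
      by (auto intro: convexD)
    have norm_y: "(norm (y - c))^2 =
        (1 - s) * (norm (w - c))^2 + s * (norm (z - c))^2 - s * (1 - s) * (norm (z - w))^2"
      unfolding y_def power2_norm_eq_inner
      by (simp add: inner_simps inner_commute algebra_simps)
    have "q w + L / 2 * (norm (w - c))^2 \<le> q y + L / 2 * (norm (y - c))^2"
      using \<open>y \<in> F\<close> by (rule min)
    moreover have "q y \<le> (1 - s) * q w + s * q z"
      unfolding y_def using assms(1) \<open>w \<in> F\<close> \<open>z \<in> F\<close> s by (intro convex_onD) auto
    moreover have "L / 2 * (norm (y - c))^2 = (1 - s) * (L / 2 * (norm (w - c))^2) +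
        s * (L / 2 * (norm (z - c))^2) - s * ((1 - s) * (L / 2 * (norm (z - w))^2))"
      unfolding norm_y by (simp add: field_simps)
    ultimately have "s * ((1 - s) * (L / 2 * (norm (z - w))^2)) \<le> s * D"
      unfolding D_def by (simp add: algebra_simps diff_divide_distrib)
    then show ?thesis using s by simp
  qed
  then have "eventually (\<lambda>s. (1 - s) * (L / 2 * (norm (z - w))^2) \<le> D) (at_right 0)"
    using eventually_at_right_real[of 0 1] by (auto elim: eventually_mono)
  moreover have "((\<lambda>s. (1 - s) * (L / 2 * (norm (z - w))^2)) \<longlongrightarrow> (1 - 0) * (L / 2 * (norm (z - w))^2)) (at_right 0)"
    by (intro tendsto_intros)
  ultimately have "(1 - 0) * (L / 2 * (norm (z - w))^2) \<le> D"
    by (intro tendsto_upperbound) auto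
  then show ?thesis unfolding D_def by simp
qed

lemma convex_on_add_affine:
  assumes "convex_on S p"
  shows "convex_on S (\<lambda>y. p y + (a + g \<bullet> (y - b)))"
proof (rule convex_on_add[OF assms])
  have "a + g \<bullet> ((s *\<^sub>R x + r *\<^sub>R y) - b) = s * (a + g \<bullet> (x - b)) + r * (a + g \<bullet> (y - b))"
    if "s + r = 1" for s r x y
  proof -
    have r: "r = 1 - s" using that by simp
    show ?thesis unfolding r by (simp add: inner_simps algebra_simps)
  qed
  then show "convex_on S (\<lambda>y. a + g \<bullet> (y - b))"
    using assms by (simp add: convex_on_def)
qed

text \<open>The smooth part enters only through \<open>lower\<close> (convexity) and
  \<open>upper\<close> (an \<open>L\<close>-Lipschitz gradient). The weights \<open>1 / t i\<close>
  of the first \<open>N\<close> models sum to at least \<open>((N + 1) / 2)^2\<close>; dividing the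
  estimate-sequence inequality by this sum gives the rate.\<close>

lemma APG_suboptimality:
  fixes p f :: "'a::real_inner \<Rightarrow> real" and G :: "'a \<Rightarrow> 'a" and u v w :: "nat \<Rightarrow> 'a"
  assumes p: "convex_on F p" and "0 \<le> L"
    and lower: "\<And>x y. f x + G x \<bullet> (y - x) \<le> f y"
    and upper: "\<And>x y. f y \<le> f x + G x \<bullet> (y - x) + L / 2 * (norm (y - x))^2"
    and "w 0 = c" and t0: "t 0 = 1"
    and v: "\<And>l. l < N \<Longrightarrow> v l = (1 - t l) *\<^sub>R u l + t l *\<^sub>R w l"
    and w: "\<And>l. l < N \<Longrightarrow> is_arg_min
      (\<lambda>y. (\<Sum>i\<le>l. (1 / t i) * (p y + G (v i) \<bullet> y)) + L * (1 / 2 * (norm (y - c))^2))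
      (\<lambda>y. y \<in> F) (w (Suc l))"
    and u: "\<And>l. l < N \<Longrightarrow> is_arg_min
      (\<lambda>y. p y + G (v l) \<bullet> y + L / 2 * (norm (y - v l))^2) (\<lambda>y. y \<in> F) (u (Suc l))"
    and t: "\<And>l. l < N \<Longrightarrow> t (Suc l) = (sqrt ((t l)^4 + 4 * (t l)^2) - (t l)^2) / 2"
    and "0 < N"
  shows "u N \<in> F"
    and "y \<in> F \<Longrightarrow> p (u N) + f (u N) \<le> p y + f y + 2 * L * (norm (y - c))^2 / (real N + 1)^2"
proof -
  text \<open>\<open>m i\<close> is a lower model of \<open>p + f\<close>, exact to second order at \<open>v i\<close>; \<open>w n\<close> minimizes
    \<open>Q n + L / 2 * (norm (z - c))\<^sup>2\<close>, and \<open>inv\<close> below is the estimate-sequence invariant. At \<open>n = 0\<close> its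
    left-hand side vanishes, so \<open>u 0\<close> need not lie in \<open>F\<close>.\<close>
  define m where "m i z = p z + ((f (v i)) + G (v i) \<bullet> (z - v i))" for i z
  define Q where "Q n z = (\<Sum>i<n. 1 / t i * m i z)" for n z
  note step = APG_step_size[where N = N, OF t0 t]
  have t_pos: "0 < t i" if "i \<le> N" for i using step that by blast
  have "convex F" using p by (simp add: convex_on_def)
  have m_le: "m i z \<le> p z + f z" for i z
    unfolding m_def using lower[of "v i" z] by simp
  have m_convex: "convex_on F (m i)" for i
    unfolding m_def using p by (rule convex_on_add_affine)
  have Q_convex: "convex_on F (Q n)" if "n \<le> N" for n
    using that
  proof (induction n)
    case 0
    then show ?case using \<open>convex F\<close> by (simp add: Q_def convex_on_def)
  next
    case (Suc n)
    have "0 \<le> 1 / t n" using t_pos[of n] Suc.prems by simp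
    then have "convex_on F (\<lambda>z. Q n z + 1 / t n * m n z)"
      using Suc m_convex by (intro convex_on_add convex_on_cmul) auto
    then show ?case unfolding Q_def by simp
  qed
  \<comment> \<open>The objective of the algorithm omits the constants
    \<open>f (v i) - G (v i) \<bullet> v i\<close>, which do not affect minimizers.\<close>
  have w_min: "is_arg_min (\<lambda>z. Q (Suc n) z + L / 2 * (norm (z - c))^2) (\<lambda>z. z \<in> F) (w (Suc n))"
    if "n < N" for n
  proof -
    have "Q (Suc n) z + L / 2 * (norm (z - c))^2 =
        ((\<Sum>i\<le>n. (1 / t i) * (p z + G (v i) \<bullet> z)) + L * (1 / 2 * (norm (z - c))^2)) +
        (\<Sum>i\<le>n. 1 / t i * (f (v i) - G (v i) \<bullet> v i))" for z
      unfolding Q_def m_def lessThan_Suc_atMost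
      by (simp add: inner_simps sum.distrib[symmetric] algebra_simps)
    then show ?thesis using w[OF that] by (simp add: is_arg_min_def)
  qed
  \<comment> \<open>At \<open>n = 0\<close> this is an equality, as \<open>Q 0\<close> vanishes and
    \<open>w 0 = c\<close>.\<close>
  have growth: "Q n (w n) + L / 2 * (norm (w n - c))^2 + L / 2 * (norm (z - w n))^2
      \<le> Q n z + L / 2 * (norm (z - c))^2" if "n \<le> N" "z \<in> F" for n z
  proof (cases n)
    case 0
    then show ?thesis using \<open>w 0 = c\<close> by (simp add: Q_def)
  next
    case (Suc k)
    then show ?thesis
      using arg_min_quadratic_growth[OF Q_convex \<open>0 \<le> L\<close> \<open>z \<in> F\<close> w_min[of k]] that by simp
  qed
  have inv: "(1 - t n) / (t n)^2 * (p (u n) + f (u n)) \<le> Q n (w n) + L / 2 * (norm (w n - c))^2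
      \<and> (0 < n \<longrightarrow> u n \<in> F)" if "n \<le> N" for n
    using that
  proof (induction n)
    case 0
    then show ?case using t0 \<open>w 0 = c\<close> by (simp add: Q_def)
  next
    case (Suc n)
    then have "n < N" by simp
    define r where "r = t n"
    define z where "z = w (Suc n)"
    \<comment> \<open>\<open>y\<close> is \<open>v n\<close> with \<open>w n\<close> replaced by
      \<open>w (Suc n)\<close>. Its squared distance to \<open>v n\<close> carries the factor
      \<open>r^2\<close>, so after division by \<open>r^2\<close> it is exactly the growth
      term.\<close>
    define y where "y = (1 - r) *\<^sub>R u n + r *\<^sub>R z"
    have r: "0 < r" "r \<le> 1" using step[of n] \<open>n < N\<close> unfolding r_def by auto
    have "z \<in> F" unfolding z_def using w_min[OF \<open>n < N\<close>] by (simp add: is_arg_min_def)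
    \<comment> \<open>At \<open>n = 0\<close> the weight \<open>r\<close> is 1, so
      \<open>u 0\<close>, possibly outside \<open>F\<close>, drops out.\<close>
    have "y \<in> F"
    proof (cases n)
      case 0
      then show ?thesis using t0 \<open>z \<in> F\<close> by (simp add: y_def r_def)
    next
      case (Suc k)
      then show ?thesis
        unfolding y_def using Suc.IH \<open>n < N\<close> \<open>z \<in> F\<close> r \<open>convex F\<close> by (intro convexD) auto
    qed
    have m_y: "m n y \<le> (1 - r) * m n (u n) + r * m n z"
    proof (cases n)
      case 0
      then show ?thesis using t0 by (simp add: y_def r_def)
    next
      case (Suc k)
      then show ?thesis
        unfolding y_def using Suc.IH \<open>n < N\<close> \<open>z \<in> F\<close> r by (intro convex_onD[OF m_convex]) auto
    qed
    have "y - v n = r *\<^sub>R (z - w n)"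
      unfolding y_def v[OF \<open>n < N\<close>] r_def by (simp add: algebra_simps)
    then have dist_y: "L / 2 * (norm (y - v n))^2 = r^2 * (L / 2 * (norm (z - w n))^2)"
      by (simp add: power_mult_distrib)
    have "u (Suc n) \<in> F" using u[OF \<open>n < N\<close>] by (simp add: is_arg_min_def)
    have "p (u (Suc n)) + f (u (Suc n)) \<le> m n (u (Suc n)) + L / 2 * (norm (u (Suc n) - v n))^2"
      unfolding m_def using upper[of "u (Suc n)" "v n"] by simp
    also have "\<dots> \<le> m n y + L / 2 * (norm (y - v n))^2"
      using u[OF \<open>n < N\<close>] \<open>y \<in> F\<close> unfolding m_def
      by (force simp: is_arg_min_def not_less inner_simps)
    also have "\<dots> \<le> (1 - r) * (p (u n) + f (u n)) + r * m n z + r^2 * (L / 2 * (norm (z - w n))^2)"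
      unfolding dist_y using m_y mult_left_mono[OF m_le[of n "u n"], of "1 - r"] r by linarith
    finally have "1 / r^2 * (p (u (Suc n)) + f (u (Suc n))) \<le>
        1 / r^2 * ((1 - r) * (p (u n) + f (u n)) + r * m n z + r^2 * (L / 2 * (norm (z - w n))^2))"
      by (rule mult_left_mono) simp
    also have "\<dots> = (1 - r) / r^2 * (p (u n) + f (u n)) + 1 / r * m n z + L / 2 * (norm (z - w n))^2"
      using r by (simp add: field_simps power2_eq_square)
    also have "\<dots> \<le> Q n (w n) + L / 2 * (norm (w n - c))^2 + 1 / r * m n z + L / 2 * (norm (z - w n))^2"
      using Suc.IH \<open>n < N\<close> unfolding r_def by simp
    also have "\<dots> \<le> Q n z + L / 2 * (norm (z - c))^2 + 1 / r * m n z"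
      using growth[of n z] \<open>n < N\<close> \<open>z \<in> F\<close> by simp
    also have "\<dots> = Q (Suc n) z + L / 2 * (norm (z - c))^2"
      unfolding Q_def r_def by simp
    \<comment> \<open>Both sides are the sum of the weights up to index \<open>n\<close>.\<close>
    also have "1 / r^2 = (1 - t (Suc n)) / (t (Suc n))^2"
      using step[of n] step[of "Suc n"] \<open>n < N\<close> unfolding r_def by (simp add: lessThan_Suc_atMost)
    finally show ?case unfolding z_def using \<open>u (Suc n) \<in> F\<close> by simp
  qed
  show "u N \<in> F" using inv[of N] \<open>0 < N\<close> by simp
  assume "y \<in> F"
  \<comment> \<open>The weight sum \<open>R\<close> also equals \<open>1 / (t k)^2\<close> with
    \<open>k = N - 1\<close>, so the bound \<open>(k + 2) / 2\<close> becomes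
    \<open>(N + 1) / 2\<close>.\<close>
  obtain k where k: "N = Suc k" using \<open>0 < N\<close> gr0_implies_Suc by blast
  define R where "R = (1 - t N) / (t N)^2"
  have R: "R = (\<Sum>i<N. 1 / t i)" and "R = 1 / (t k)^2" and "(real k + 2) / 2 \<le> 1 / t k"
    using step[of N] step[of k] unfolding R_def k by (auto simp: lessThan_Suc_atMost)
  have "((real k + 2) / 2)^2 \<le> (1 / t k)^2"
    using \<open>(real k + 2) / 2 \<le> 1 / t k\<close> by (intro power_mono) auto
  then have R_ge: "((real N + 1) / 2)^2 \<le> R" using \<open>R = 1 / (t k)^2\<close> k by (simp add: power_one_over add.commute)
  moreover have "0 < ((real N + 1) / 2)^2" by simp
  ultimately have "0 < R" by linarith
  have "R * (p (u N) + f (u N)) \<le> Q N (w N) + L / 2 * (norm (w N - c))^2"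
    unfolding R_def using inv[of N] by simp
  also have "\<dots> \<le> Q N y + L / 2 * (norm (y - c))^2"
  proof -
    have "0 \<le> L / 2 * (norm (y - w N))^2" using \<open>0 \<le> L\<close> by simp
    then show ?thesis using growth[of N y] \<open>y \<in> F\<close> by linarith
  qed
  also have "Q N y \<le> R * (p y + f y)"
    unfolding Q_def R sum_distrib_right
    using m_le t_pos by (intro sum_mono mult_left_mono) (auto simp: less_imp_le)
  finally have "p (u N) + f (u N) \<le> p y + f y + (L / 2 * (norm (y - c))^2) / R"
    using \<open>0 < R\<close> by (simp add: field_simps)
  also have "(L / 2 * (norm (y - c))^2) / R \<le> (L / 2 * (norm (y - c))^2) / ((real N + 1) / 2)^2"
    using R_ge \<open>0 \<le> L\<close> \<open>0 < R\<close> by (intro divide_left_mono) auto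
  also have "\<dots> = 2 * L * (norm (y - c))^2 / (real N + 1)^2"
    by (simp add: power_divide)
  finally show "p (u N) + f (u N) \<le> p y + f y + 2 * L * (norm (y - c))^2 / (real N + 1)^2" by simp
qed

section \<open>The subproblems of the augmented Lagrangian method\<close>

lemma norm_le_l1_norm: "norm x \<le> l1_norm x"
  unfolding l1_norm_def by (rule norm_le_l1_cart)

lemma l1_norm_le: "l1_norm (x::real^'n) \<le> real CARD('n) * norm x"
  unfolding l1_norm_def using sum_bounded_above[of UNIV "\<lambda>i. \<bar>x $ i\<bar>" "norm x"] component_le_norm_cart[of x] by simp

lemma l1_norm_triangle: "l1_norm (x + y) \<le> l1_norm x + l1_norm y"
  unfolding l1_norm_def sum.distrib[symmetric] by (intro sum_mono) (simp add: abs_triangle_ineq)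

lemma l1_norm_scaleR: "l1_norm (c *\<^sub>R x) = \<bar>c\<bar> * l1_norm x"
  unfolding l1_norm_def by (simp add: abs_mult sum_distrib_left)

lemma convex_on_l1_norm: "convex S \<Longrightarrow> convex_on S l1_norm"
  unfolding convex_on_def by (smt (verit) l1_norm_triangle l1_norm_scaleR)

lemma convex_l1_ball: "convex {y. l1_norm y \<le> r}"
  unfolding convex_alt
proof (intro ballI allI impI, elim conjE)
  fix x y :: "real^'n" and u :: real
  assume "x \<in> {y. l1_norm y \<le> r}" "y \<in> {y. l1_norm y \<le> r}" "0 \<le> u" "u \<le> 1"
  then have "l1_norm ((1 - u) *\<^sub>R x + u *\<^sub>R y) \<le> (1 - u) * l1_norm x + u * l1_norm y"
    by (intro convex_onD[OF convex_on_l1_norm[OF convex_UNIV]]) auto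
  also have "\<dots> \<le> r"
    using \<open>x \<in> _\<close> \<open>y \<in> _\<close> \<open>0 \<le> u\<close> \<open>u \<le> 1\<close> by (intro convex_bound_le) auto
  finally show "(1 - u) *\<^sub>R x + u *\<^sub>R y \<in> {y. l1_norm y \<le> r}" by simp
qed

lemma continuous_on_l1_norm: "continuous_on S l1_norm"
  unfolding l1_norm_def by (intro continuous_intros)

section \<open>The least-squares term and its gradient\<close>

lemma GDERIV_unique:
  assumes "GDERIV f x :> D" and "GDERIV f x :> E"
  shows "D = E"
  using has_derivative_unique[OF assms[unfolded gderiv_def]]
  by (metis inner_commute vector_eq_ldot)

lemma residual_expansion:
  fixes A :: "real^'n^'m"
  shows "1 / 2 * (norm (A *v y - c))^2 = 1 / 2 * (norm (A *v x - c))^2 +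
    (transpose A *v (A *v x - c)) \<bullet> (y - x) + 1 / 2 * (norm (A *v (y - x)))^2"
proof -
  have "(transpose A *v (A *v x - c)) \<bullet> (y - x) = (A *v (y - x)) \<bullet> (A *v x - c)"
    by (metis inner_commute inner_transpose_mult)
  moreover have "A *v y - c = (A *v x - c) + A *v (y - x)"
    by (simp add: matrix_vector_mult_diff_distrib)
  then have "(norm (A *v y - c))^2 = (norm (A *v x - c))^2 +
      2 * ((A *v (y - x)) \<bullet> (A *v x - c)) + (norm (A *v (y - x)))^2"
    unfolding power2_norm_eq_inner by (simp add: inner_simps inner_commute)
  ultimately show ?thesis by simp
qed

lemma gradient_residual:
  fixes A :: "real^'n^'m"
  shows "gradient (\<lambda>y. 1 / 2 * (norm (A *v y - c))^2) x = transpose A *v (A *v x - c)"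
proof -
  have "GDERIV (\<lambda>y. 1 / 2 * (norm (A *v y - c))^2) x :> transpose A *v (A *v x - c)"
    unfolding gderiv_def power2_norm_eq_inner
    by (auto intro!: derivative_eq_intros bounded_linear.has_derivative[OF matrix_vector_mul_bounded_linear]
        simp: inner_transpose_mult inner_commute fun_eq_iff simp del: transpose_matrix_vector)
  then show ?thesis unfolding gradient_def using GDERIV_unique by blast
qed

lemma sigma_max_pos:
  assumes "A *v y \<noteq> 0"
  shows "0 < sigma_max A"
proof -
  have "0 < sigma_max A * norm y"
    using norm_matrix_vector_mult_le_sigma_max[of A y] assms by (smt (verit) zero_less_norm_iff)
  then show ?thesis by (simp add: zero_less_mult_iff)
qed

text \<open>This merges the two stopping tests into one inequality, valid for every \<open>y\<close>
  and not only on the ball to which the subroutine is restricted.\<close>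

lemma lasso_APG_output_suboptimality:
  fixes A :: "real^'n^'m" and b \<theta> :: "real^'m" and x0 xs z :: "real^'n"
    and lam eps tau eta :: real
  defines "P \<equiv> \<lambda>y. lam * l1_norm y + 1 / 2 * (norm (A *v y - b - lam *\<^sub>R \<theta>))^2"
  assumes "0 < sigma_max A" and "0 < lam" and "0 < eps" and "0 < tau"
    and "0 < eta" and "l1_norm xs \<le> eta" and "A *v xs = b"
    and out: "APG_output (\<lambda>y. lam * l1_norm y)
      (\<lambda>y. 1 / 2 * (norm (A *v y - b - lam *\<^sub>R \<theta>))^2)
      (\<lambda>y. 1 / 2 * (norm (y - x0))^2)
      {y. l1_norm y \<le> eta + lam / 2 * (norm \<theta>)^2}
      ((sigma_max A)^2)
      (sigma_max A * (eta + lam / 2 * (norm \<theta>)^2 + norm x0) * sqrt (2 / eps)) tau x0 z"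
  shows "P z \<le> P y + tau * norm (y - z) + eps"
proof -
  let ?f = "\<lambda>y. 1 / 2 * (norm (A *v y - b - lam *\<^sub>R \<theta>))^2"
  let ?p = "\<lambda>y. lam * l1_norm y"
  let ?h = "\<lambda>y. 1 / 2 * (norm (y - x0))^2"
  let ?L = "(sigma_max A)^2"
  define r where "r = eta + lam / 2 * (norm \<theta>)^2"
  define lmax where "lmax = sigma_max A * (r + norm x0) * sqrt (2 / eps)"
  define F where "F = {y::real^'n. l1_norm y \<le> r}"
  define small where "small = (\<lambda>y. \<exists>g \<in> subdifferential (\<lambda>x. ?p x + ?f x) y. norm g \<le> tau)"
  have "0 < r" unfolding r_def using \<open>0 < eta\<close> \<open>0 < lam\<close> by (simp add: add_pos_nonneg)
  have "0 < lmax" unfolding lmax_def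
    using \<open>0 < r\<close> \<open>0 < sigma_max A\<close> \<open>0 < eps\<close> by (simp add: add_pos_nonneg)
  obtain u v w :: "nat \<Rightarrow> real^'n" and t :: "nat \<Rightarrow> real" and N where
    w0: "is_arg_min ?h (\<lambda>_. True) (w 0)" and t0: "t 0 = 1"
    and v: "\<forall>l\<le>N. v l = (1 - t l) *\<^sub>R u l + t l *\<^sub>R w l"
    and step: "\<forall>l<N. real l < lmax \<and> \<not> small (v l) \<and>
          is_arg_min (\<lambda>y. (\<Sum>i\<le>l. (1 / t i) * (?p y + gradient ?f (v i) \<bullet> y)) + ?L * ?h y)
            (\<lambda>y. y \<in> F) (w (Suc l)) \<and>
          is_arg_min (\<lambda>y. ?p y + gradient ?f (v l) \<bullet> y + ?L / 2 * (norm (y - v l))^2)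
            (\<lambda>y. y \<in> F) (u (Suc l)) \<and>
          t (Suc l) = (sqrt ((t l)^4 + 4 * (t l)^2) - (t l)^2) / 2"
    and stop: "if real N \<ge> lmax then z = u N else small (v N) \<and> z = v N"
    using out unfolding APG_output_def Let_def r_def[symmetric] lmax_def[symmetric] F_def[symmetric]
      small_def[symmetric]
    by blast
  show ?thesis
  proof (cases "real N \<ge> lmax")
    case False
    then obtain g where "g \<in> subdifferential P z" "norm g \<le> tau"
      using stop unfolding small_def P_def by auto
    then have "P z + g \<bullet> (y - z) \<le> P y" by (simp add: subdifferential_def)
    moreover have "- (g \<bullet> (y - z)) \<le> norm g * norm (y - z)"
      using Cauchy_Schwarz_ineq2[of g "y - z"] by linarith
    moreover have "norm g * norm (y - z) \<le> tau * norm (y - z)"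
      using \<open>norm g \<le> tau\<close> by (intro mult_right_mono) auto
    ultimately show ?thesis using \<open>0 < eps\<close> by linarith
  next
    case True
    \<comment> \<open>The returned point is thus the result of at least one proximal step, as the
      rate requires.\<close>
    then have "0 < N" using \<open>0 < lmax\<close> by (metis gr0I not_less of_nat_0)
    have z: "z = u N" using stop True by simp
    have "w 0 = x0" using w0 by (force simp: is_arg_min_def not_less dest: spec[of _ x0])
    have p: "convex_on F ?p"
      unfolding F_def using \<open>0 < lam\<close>
      by (intro convex_on_cmul convex_on_l1_norm convex_l1_ball) simp
    note expansion = residual_expansion[where A = A and c = "b + lam *\<^sub>R \<theta>",
        unfolded diff_diff_eq[symmetric]]
    note gradient = gradient_residual[where A = A and c = "b + lam *\<^sub>R \<theta>",
        unfolded diff_diff_eq[symmetric]]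
    have lower: "?f x + gradient ?f x \<bullet> (y - x) \<le> ?f y" for x y
      unfolding gradient expansion[of y x] by simp
    have upper: "?f y \<le> ?f x + gradient ?f x \<bullet> (y - x) + ?L / 2 * (norm (y - x))^2" for x y
    proof -
      have "(norm (A *v (y - x)))^2 \<le> (sigma_max A * norm (y - x))^2"
        by (intro power_mono norm_matrix_vector_mult_le_sigma_max) simp
      then show ?thesis unfolding gradient expansion[of y x] by (simp add: power_mult_distrib)
    qed
    have APG: "P z \<le> P y + eps" if "y \<in> F" for y
    proof -
      have "P z \<le> P y + 2 * ?L * (norm (y - x0))^2 / (real N + 1)^2"
        using APG_suboptimality(2)[where F = F and t = t and u = u and v = v and w = w, OF p _ lower upper
            \<open>w 0 = x0\<close> t0 _ _ _ _ \<open>0 < N\<close> that] v step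
        unfolding P_def z by simp
      \<comment> \<open>\<open>lmax\<close> is calibrated for this:
        \<open>eps * lmax^2 = 2 * L * (r + norm x0)^2\<close>, and \<open>r + norm x0\<close> bounds
        the distance from \<open>x0\<close> to points of \<open>F\<close>.\<close>
      also have "2 * ?L * (norm (y - x0))^2 / (real N + 1)^2 \<le> eps"
      proof -
        have "norm y \<le> r" using that norm_le_l1_norm[of y] unfolding F_def by simp
        then have "norm (y - x0) \<le> r + norm x0" using norm_triangle_ineq4[of y x0] by linarith
        then have "2 * ?L * (norm (y - x0))^2 \<le> 2 * ?L * (r + norm x0)^2"
          by (intro mult_left_mono power_mono) auto
        also have "\<dots> = eps * lmax^2"
          unfolding lmax_def using \<open>0 < eps\<close> by (simp add: power_mult_distrib)
        also have "\<dots> \<le> eps * (real N + 1)^2"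
          using True \<open>0 < lmax\<close> \<open>0 < eps\<close> by (intro mult_left_mono power_mono) auto
        finally show ?thesis by (simp add: divide_le_eq)
      qed
      finally show ?thesis by simp
    qed
    have "P z \<le> P y + eps"
    proof (cases "y \<in> F")
      \<comment> \<open>The radius \<open>r\<close> is chosen so that
        \<open>P xs \<le> lam * r\<close>. Outside \<open>F\<close> the \<open>l1\<close> term alone
        exceeds this, so \<open>xs\<close> serves as comparison point.\<close>
      case False
      have "xs \<in> F" unfolding F_def r_def using \<open>l1_norm xs \<le> eta\<close> \<open>0 < lam\<close> by (simp add: add_increasing2)
      then have "P z \<le> P xs + eps" by (rule APG)
      also have "P xs = lam * (l1_norm xs + lam / 2 * (norm \<theta>)^2)"
        unfolding P_def using \<open>A *v xs = b\<close> \<open>0 < lam\<close> by (simp add: power_mult_distrib power2_eq_square algebra_simps)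
      also have "\<dots> \<le> lam * l1_norm y"
        using False \<open>l1_norm xs \<le> eta\<close> \<open>0 < lam\<close> unfolding F_def r_def by (intro mult_left_mono) auto
      also have "\<dots> \<le> P y" unfolding P_def by simp
      finally show ?thesis by simp
    qed (rule APG)
    moreover have "0 \<le> tau * norm (y - z)" using \<open>0 < tau\<close> by simp
    ultimately show ?thesis by linarith
  qed
qed

text \<open>The updated multiplier \<open>q\<close> satisfies
  \<open>A *v z - b - lam *\<^sub>R \<theta> = (- lam) *\<^sub>R q\<close>. With a step of length at
  most \<open>lam\<close>, the linear decrease, the \<open>l1\<close> change and the quadratic term
  all scale with \<open>lam^2\<close>; dividing by it leaves the stated bound.\<close>

lemma approx_minimizer_multiplier_bound:
  fixes A :: "real^'n^'m" and b \<theta> :: "real^'m" and z :: "real^'n" and lam eps tau :: real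
  defines "P \<equiv> \<lambda>y. lam * l1_norm y + 1 / 2 * (norm (A *v y - b - lam *\<^sub>R \<theta>))^2"
  assumes "0 < lam" and "0 \<le> tau"
    and approx: "\<And>y. P z \<le> P y + tau * norm (y - z) + eps"
  shows "norm (transpose A *v (\<theta> - (1 / lam) *\<^sub>R (A *v z - b)))
    \<le> real CARD('n) + (sigma_max A)^2 / 2 + eps / lam^2 + tau / lam"
proof -
  define q where "q = \<theta> - (1 / lam) *\<^sub>R (A *v z - b)"
  \<comment> \<open>\<open>sgn\<close> normalizes a nonzero vector and sends 0 to 0, so no case
    split on \<open>q\<close> is needed for \<open>norm d \<le> 1\<close>.\<close>
  define d where "d = sgn (transpose A *v q)"
  have "norm d \<le> 1" unfolding d_def by (simp add: norm_sgn)
  have "A *v z - b - lam *\<^sub>R \<theta> = (- lam) *\<^sub>R q"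
    unfolding q_def using \<open>0 < lam\<close> by (simp add: scaleR_diff_right)
  then have "transpose A *v (A *v z - b - lam *\<^sub>R \<theta>) = (- lam) *\<^sub>R (transpose A *v q)"
    by (simp only: matrix_vector_mult_scaleR)
  moreover have "(transpose A *v q) \<bullet> d = norm (transpose A *v q)"
    unfolding d_def by (cases "transpose A *v q = 0")
      (simp_all add: sgn_div_norm power2_norm_eq_inner[symmetric] power2_eq_square del: transpose_matrix_vector)
  ultimately have grad: "(transpose A *v (A *v z - b - lam *\<^sub>R \<theta>)) \<bullet> (lam *\<^sub>R d) =
      - (lam^2 * norm (transpose A *v q))"
    by (simp add: power2_eq_square)
  have l1: "l1_norm (z + lam *\<^sub>R d) \<le> l1_norm z + lam * real CARD('n)"
  proof -
    have "l1_norm d \<le> real CARD('n) * 1"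
      using \<open>norm d \<le> 1\<close> by (intro order_trans[OF l1_norm_le] mult_left_mono) auto
    then have "l1_norm (lam *\<^sub>R d) \<le> lam * real CARD('n)"
      using \<open>0 < lam\<close> by (simp add: l1_norm_scaleR)
    then show ?thesis using l1_norm_triangle[of z "lam *\<^sub>R d"] by linarith
  qed
  have "norm (A *v (lam *\<^sub>R d)) \<le> sigma_max A * norm (lam *\<^sub>R d)"
    by (rule norm_matrix_vector_mult_le_sigma_max)
  then have "(norm (A *v (lam *\<^sub>R d)))^2 \<le> (sigma_max A)^2 * (norm (lam *\<^sub>R d))^2"
    unfolding power_mult_distrib[symmetric] by (intro power_mono) auto
  also have "\<dots> \<le> (sigma_max A)^2 * lam^2"
    using \<open>norm d \<le> 1\<close> \<open>0 < lam\<close> by (intro mult_left_mono power_mono) auto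
  finally have quad: "(norm (A *v (lam *\<^sub>R d)))^2 \<le> (sigma_max A)^2 * lam^2" .
  have tau: "tau * norm (lam *\<^sub>R d) \<le> tau * lam"
    using \<open>norm d \<le> 1\<close> \<open>0 < lam\<close> \<open>0 \<le> tau\<close> by (intro mult_left_mono) auto
  have "P (z + lam *\<^sub>R d) = lam * l1_norm (z + lam *\<^sub>R d) + 1 / 2 * (norm (A *v z - b - lam *\<^sub>R \<theta>))^2
      - lam^2 * norm (transpose A *v q) + 1 / 2 * (norm (A *v (lam *\<^sub>R d)))^2"
    unfolding P_def
    using residual_expansion[of A "z + lam *\<^sub>R d" "b + lam *\<^sub>R \<theta>" z] grad
    by (simp add: diff_diff_eq[symmetric])
  moreover have "P z \<le> P (z + lam *\<^sub>R d) + tau * norm (lam *\<^sub>R d) + eps"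
    using approx[of "z + lam *\<^sub>R d"] by simp
  moreover have "lam * l1_norm (z + lam *\<^sub>R d) \<le> lam * (l1_norm z + lam * real CARD('n))"
    using l1 \<open>0 < lam\<close> by (intro mult_left_mono) auto
  ultimately have "lam^2 * norm (transpose A *v q)
      \<le> lam * (lam * real CARD('n)) + 1 / 2 * ((sigma_max A)^2 * lam^2) + tau * lam + eps"
    using quad tau unfolding P_def distrib_left by linarith
  also have "\<dots> = lam^2 * (real CARD('n) + (sigma_max A)^2 / 2 + eps / lam^2 + tau / lam)"
    using \<open>0 < lam\<close> by (simp add: field_simps power2_eq_square)
  finally show ?thesis using \<open>0 < lam\<close> unfolding q_def by simp
qed

text \<open>At the feasible \<open>xs\<close> the quadratic term is only
  \<open>lam^2 / 2 * (norm \<theta>)^2\<close>. The distance in the \<open>tau\<close> term is at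
  most the sum of both \<open>l1\<close> norms; moving the share of \<open>z\<close> to the left
  produces the factor \<open>1 - tau / lam\<close>.\<close>

lemma approx_minimizer_l1_bound:
  fixes A :: "real^'n^'m" and b \<theta> :: "real^'m" and z xs :: "real^'n" and lam eps tau :: real
  defines "P \<equiv> \<lambda>y. lam * l1_norm y + 1 / 2 * (norm (A *v y - b - lam *\<^sub>R \<theta>))^2"
  assumes "0 < lam" and "0 \<le> tau" and "A *v xs = b" and "norm \<theta> \<le> C"
    and approx: "P z \<le> P xs + tau * norm (xs - z) + eps"
  shows "l1_norm z * (1 - tau / lam)
    \<le> l1_norm xs * (1 + tau / lam) + lam * (C^2 / 2 + eps / lam^2)"
proof -
  have "norm (xs - z) \<le> l1_norm xs + l1_norm z"
    using norm_triangle_ineq4[of xs z] norm_le_l1_norm[of xs] norm_le_l1_norm[of z] by linarith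
  then have "tau * norm (xs - z) \<le> tau * (l1_norm xs + l1_norm z)"
    using \<open>0 \<le> tau\<close> by (intro mult_left_mono) auto
  moreover have "lam * l1_norm z \<le> P z" unfolding P_def by simp
  moreover have "P xs = lam * l1_norm xs + lam^2 / 2 * (norm \<theta>)^2"
    unfolding P_def using \<open>A *v xs = b\<close> by (simp add: power_mult_distrib)
  moreover have "lam^2 / 2 * (norm \<theta>)^2 \<le> lam^2 / 2 * C^2"
    using \<open>norm \<theta> \<le> C\<close> by (intro mult_left_mono power_mono) auto
  ultimately have "lam * l1_norm z \<le> lam * l1_norm xs + lam^2 / 2 * C^2 + tau * (l1_norm xs + l1_norm z) + eps"
    using approx by linarith
  also have "\<dots> = lam * (l1_norm xs * (1 + tau / lam) + lam * (C^2 / 2 + eps / lam^2) + l1_norm z * (tau / lam))"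
    using \<open>0 < lam\<close> by (simp add: field_simps power2_eq_square)
  finally show ?thesis using \<open>0 < lam\<close> by (simp add: right_diff_distrib)
qed

section \<open>Convergence\<close>

text \<open>Otherwise some subsequence stays away from \<open>a\<close>, and by boundedness a
  further subsequence converges to a limit other than \<open>a\<close>.\<close>

lemma tendsto_if_subseq_limits_eq:
  fixes X :: "nat \<Rightarrow> 'a::heine_borel"
  assumes "bounded (range X)"
    and lim: "\<And>r l. strict_mono r \<Longrightarrow> (X \<circ> r) \<longlonglongrightarrow> l \<Longrightarrow> l = a"
  shows "X \<longlonglongrightarrow> a"
proof (rule ccontr)
  assume "\<not> X \<longlonglongrightarrow> a"
  then obtain e where "0 < e" and "\<exists>\<^sub>F n in sequentially. e \<le> dist (X n) a"
    by (auto simp: tendsto_iff not_eventually not_less)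
  then have "infinite {n. e \<le> dist (X n) a}"
    by (simp add: cofinite_eq_sequentially[symmetric] frequently_cofinite)
  then obtain r :: "nat \<Rightarrow> nat" where r: "strict_mono r" "\<And>n. e \<le> dist (X (r n)) a"
    using infinite_enumerate by blast
  have "bounded (range (X \<circ> r))" using assms(1) by (rule bounded_subset) auto
  then obtain l s where s: "strict_mono s" "((X \<circ> r) \<circ> s) \<longlonglongrightarrow> l"
    using bounded_imp_convergent_subsequence by blast
  have "l = a" using lim[of "r \<circ> s" l] r s by (simp add: strict_mono_o comp_assoc)
  moreover have "e \<le> dist l a"
    using s(2) by (rule Lim_bounded2[OF tendsto_dist[OF _ tendsto_const]]) (use r in auto)
  ultimately show False using \<open>0 < e\<close> by simp
qed

theorem corollary3p2:
  fixes A :: "real^'n^'m" and b :: "real^'m"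
    and x0 x_star :: "real^'n" and x :: "nat \<Rightarrow> real^'n"
    and eta :: real and lam eps tau :: "nat \<Rightarrow> real"
  assumes "CARD('m) < CARD('n)"
    and "rank A = CARD('m)"
    and "unique_minimizer l1_norm (\<lambda>y. A *v y = b) x_star"
    and "eta > 0" and "eta \<ge> l1_norm x_star"
    and "\<And>k. k \<ge> 1 \<Longrightarrow> lam k > 0 \<and> eps k > 0 \<and> tau k > 0"
    and "decreases_to_zero lam"
    and "decreases_to_zero eps"
    and "\<exists>B1. \<forall>k\<ge>1. eps k / (lam k)^2 \<le> B1"
    and "decreases_to_zero tau"
    and "\<exists>B2. \<forall>k\<ge>1. tau k / lam k \<le> B2"
    and "(\<lambda>k. tau k / lam k) \<longlonglongrightarrow> 0"
    and "FAL_iterates A b eta lam eps tau x0 x"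
  shows "x \<longlonglongrightarrow> x_star"
proof -
  note pos = assms(6)
  have lam_0: "lam \<longlonglongrightarrow> 0" using assms(7) by (simp add: decreases_to_zero_def)
  obtain B1 B2 where B1: "\<And>k. k \<ge> 1 \<Longrightarrow> eps k / (lam k)^2 \<le> B1"
    and B2: "\<And>k. k \<ge> 1 \<Longrightarrow> tau k / lam k \<le> B2"
    using assms(9,11) by blast
  \<comment> \<open>A feasible point with \<open>l1\<close> norm at most that of
    \<open>x_star\<close> is itself a minimizer, so uniqueness applies.\<close>
  have feasible: "A *v x_star = b"
    and minimal: "\<And>y. A *v y = b \<Longrightarrow> l1_norm y \<le> l1_norm x_star \<Longrightarrow> y = x_star"
    using assms(3) unfolding unique_minimizer_def is_arg_min_linorder by (blast intro: order_trans)+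
  \<comment> \<open>Surjectivity of \<open>A\<close> provides a nonzero value \<open>A *v y\<close>,
    so \<open>sigma_max A\<close> is positive.\<close>
  obtain y where "A *v y = axis undefined 1"
    using assms(2) unfolding full_rank_surjective by (metis surjD)
  then have "0 < sigma_max A" by (intro sigma_max_pos[of A y]) (simp add: axis_eq_0_iff)
  obtain \<theta> where "\<theta> 1 = 0"
    and out: "\<And>k. k \<ge> 1 \<Longrightarrow> APG_output (\<lambda>y. lam k * l1_norm y)
      (\<lambda>y. 1 / 2 * (norm (A *v y - b - lam k *\<^sub>R \<theta> k))^2)
      (\<lambda>y. 1 / 2 * (norm (y - x (k - 1)))^2)
      {y. l1_norm y \<le> eta + lam k / 2 * (norm (\<theta> k))^2}
      ((sigma_max A)^2)
      (sigma_max A * (eta + lam k / 2 * (norm (\<theta> k))^2 + norm (x (k - 1))) * sqrt (2 / eps k))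
      (tau k) (x (k - 1)) (x k)"
    and \<theta>_Suc: "\<And>k. k \<ge> 1 \<Longrightarrow> \<theta> (Suc k) = \<theta> k - (1 / lam k) *\<^sub>R (A *v x k - b)"
    using assms(13) unfolding FAL_iterates_def Let_def by blast
  define P where "P k y = lam k * l1_norm y + 1 / 2 * (norm (A *v y - b - lam k *\<^sub>R \<theta> k))^2" for k y
  have approx: "P k (x k) \<le> P k y + tau k * norm (y - x k) + eps k" if "k \<ge> 1" for k y
    unfolding P_def
    by (rule lasso_APG_output_suboptimality[OF \<open>0 < sigma_max A\<close> _ _ _ \<open>0 < eta\<close> assms(5) feasible out[OF that]])
      (use pos[OF that] in auto)

  obtain C where C: "\<And>k. k \<ge> 1 \<Longrightarrow> norm (\<theta> k) \<le> C"
  proof -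
    \<comment> \<open>Full row rank makes \<open>transpose A\<close> injective, hence bounded below,
      which turns bounds on the image of a multiplier into bounds on the multiplier.\<close>
    have "inj ((*v) (transpose A))"
      using assms(2) by (simp add: full_rank_injective[symmetric] rank_transpose)
    then obtain B where "B > 0" and B: "\<And>q. B * norm q \<le> norm (transpose A *v q)"
      using linear_inj_bounded_below_pos[OF matrix_vector_mul_linear] by blast
    define K where "K = real CARD('n) + (sigma_max A)^2 / 2 + B1 + B2"
    have "B * norm (\<theta> (Suc k)) \<le> K" if "k \<ge> 1" for k
    proof -
      have "norm (transpose A *v \<theta> (Suc k)) \<le>
          real CARD('n) + (sigma_max A)^2 / 2 + eps k / (lam k)^2 + tau k / lam k"
        unfolding \<theta>_Suc[OF that]
        using approx[OF that, unfolded P_def] pos[OF that]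
        by (intro approx_minimizer_multiplier_bound) auto
      then show ?thesis unfolding K_def using B[of "\<theta> (Suc k)"] B1[OF that] B2[OF that] by linarith
    qed
    then have "norm (\<theta> (Suc k)) \<le> K / B" if "k \<ge> 1" for k
      using that \<open>B > 0\<close> by (simp add: field_simps)
    \<comment> \<open>The previous bound starts at index 2; \<open>max 0\<close> covers the initial
      multiplier 0.\<close>
    then have "norm (\<theta> k) \<le> max 0 (K / B)" if "k \<ge> 1" for k
      using that \<open>\<theta> 1 = 0\<close> by (cases k; cases "k = 1") (auto simp: le_max_iff_disj)
    then show thesis using that by blast
  qed

  have residual: "(\<lambda>k. A *v x k) \<longlonglongrightarrow> b"
  proof -
    have "norm (A *v x k - b) \<le> lam k * (2 * C)" if "k \<ge> 1" for k
    proof -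
      have "A *v x k - b = lam k *\<^sub>R (\<theta> k - \<theta> (Suc k))"
        unfolding \<theta>_Suc[OF that] using pos[OF that] by simp
      moreover have "norm (\<theta> k - \<theta> (Suc k)) \<le> 2 * C"
        using norm_triangle_ineq4[of "\<theta> k" "\<theta> (Suc k)"] C[OF that] C[of "Suc k"] by simp
      ultimately show ?thesis using pos[OF that] by simp
    qed
    then have "eventually (\<lambda>k. norm (A *v x k - b) \<le> lam k * (2 * C)) sequentially"
      using eventually_sequentially by blast
    moreover have "(\<lambda>k. lam k * (2 * C)) \<longlonglongrightarrow> 0" using tendsto_mult_left_zero[OF lam_0] .
    ultimately have "(\<lambda>k. A *v x k - b) \<longlonglongrightarrow> 0" by (rule Lim_null_comparison)
    then show ?thesis by (simp add: LIM_zero_iff)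
  qed

  define r where "r k = tau k / lam k" for k
  \<comment> \<open>\<open>M k\<close> is the \<open>l1\<close> bound solved for
    \<open>l1_norm (x k)\<close>, with \<open>B1\<close> in place of
    \<open>eps k / (lam k)^2\<close>. The division requires \<open>r k < 1\<close>, which holds
    eventually.\<close>
  define M where "M k = (l1_norm x_star * (1 + r k) + lam k * (C^2 / 2 + B1)) / (1 - r k)" for k
  have r_0: "r \<longlonglongrightarrow> 0" unfolding r_def by (rule assms(12))
  have "M \<longlonglongrightarrow> (l1_norm x_star * (1 + 0) + 0 * (C^2 / 2 + B1)) / (1 - 0)"
    unfolding M_def by (intro tendsto_intros r_0 lam_0) simp
  then have M_lim: "M \<longlonglongrightarrow> l1_norm x_star" by simp
  have "eventually (\<lambda>k. k \<ge> 1 \<and> r k < 1) sequentially"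
    using order_tendstoD(2)[OF r_0, of 1] eventually_ge_at_top[of 1] by (simp add: eventually_conj)
  then have x_le_M: "eventually (\<lambda>k. l1_norm (x k) \<le> M k) sequentially"
  proof (rule eventually_mono, elim conjE)
    fix k :: nat assume k: "k \<ge> 1" "r k < 1"
    have "l1_norm (x k) * (1 - r k) \<le> l1_norm x_star * (1 + r k) + lam k * (C^2 / 2 + eps k / (lam k)^2)"
      unfolding r_def using approx[OF k(1), of x_star, unfolded P_def] pos[OF k(1)] feasible C[OF k(1)]
      by (intro approx_minimizer_l1_bound) auto
    also have "\<dots> \<le> l1_norm x_star * (1 + r k) + lam k * (C^2 / 2 + B1)"
      using B1[OF k(1)] pos[OF k(1)] by simp
    finally show "l1_norm (x k) \<le> M k" unfolding M_def using k(2) by (simp add: le_divide_eq)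
  qed

  show ?thesis
  proof (rule tendsto_if_subseq_limits_eq)
    \<comment> \<open>Convergence of \<open>M\<close> bounds all but finitely many iterates, hence
      the whole sequence.\<close>
    have "eventually (\<lambda>k. norm (x k) \<le> l1_norm x_star + 1) sequentially"
      using eventually_conj[OF x_le_M order_tendstoD(2)[OF M_lim, of "l1_norm x_star + 1"]]
      by (auto elim!: eventually_mono intro: order_trans[OF norm_le_l1_norm])
    then have "Bfun x sequentially" by (rule BfunI)
    then show "bounded (range x)" by (simp add: Bseq_eq_bounded)
  next
    fix s l assume s: "strict_mono s" and lim: "(x \<circ> s) \<longlonglongrightarrow> l"
    have "(\<lambda>k. A *v (x \<circ> s) k) \<longlonglongrightarrow> A *v l"
      using lim by (rule bounded_linear.tendsto[OF matrix_vector_mul_bounded_linear])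
    moreover have "(\<lambda>k. A *v (x \<circ> s) k) \<longlonglongrightarrow> b"
      using LIMSEQ_subseq_LIMSEQ[OF residual s] by (simp add: o_def)
    ultimately have "A *v l = b" by (rule LIMSEQ_unique)
    moreover have "l1_norm l \<le> l1_norm x_star"
    proof (rule tendsto_le[OF sequentially_bot])
      show "(\<lambda>k. M (s k)) \<longlonglongrightarrow> l1_norm x_star"
        using LIMSEQ_subseq_LIMSEQ[OF M_lim s] by (simp add: o_def)
      show "(\<lambda>k. l1_norm (x (s k))) \<longlonglongrightarrow> l1_norm l"
        using continuous_on_tendsto_compose[OF continuous_on_l1_norm[of UNIV] lim] by (simp add: o_def)
      show "eventually (\<lambda>k. l1_norm (x (s k)) \<le> M (s k)) sequentially"
        using x_le_M filterlim_subseq[OF s] by (rule eventually_compose_filterlim)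
    qed
    ultimately show "l = x_star" by (rule minimal)
  qed
qed

end
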